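(* Let $N,n\in\mathbb{N}$, let $\Omega\subset\mathbb{R}^n$ be open, let $p\in[1,\infty)$ with $p\ge N\wedge n$, let $U=W^{1,p}(\Omega,\mathbb{R}^N)$, let $V$ be a Banach space, $K:U\to V$ a (possibly nonlinear) map, $v^\dagger\in V$, $q\ge1$, and $\mathcal{R}:U\to\mathbb{R}\cup\{+\infty\}$. For $\alpha>0$ and $u\in U$ write $\mathcal{T}_\alpha(u;v^\dagger)=\|K(u)-v^\dagger\|^q+\alpha\mathcal{R}(u)$. Assume that $K$ is Gâteaux differentiable at an $\mathcal{R}$-minimizing solution $u^\dagger$ (of $K(u)=v^\dagger$) and that $\mathcal{R}$ has a $W_{\mathrm{poly}}$-subgradient $w$ at $u^\dagger$. In addition, suppose there is an $\omega^*\in V^*$ as well as constants $\beta_1\in[0,1)$, $\bar\alpha>0$, $\rho>\bar\alpha\mathcal{R}(u^\dagger)$ such that $$w'(u^\dagger)=K'(u^\dagger)^\#\omega^*$$ and $$\|\omega^*\|\,\|K(u)-v^\dagger-K'(u^\dagger)(u-u^\dagger)\|+w(u^\dagger)-w(u)-\langle w'(u^\dagger),u^\dagger-u\rangle_{U^*,U}\le\beta_1D^{\mathrm{poly}}_w(u;u^\dagger)$$ for all $u\in U$ satisfying $\mathcal{T}_{\bar\alpha}(u;v^\dagger)\le\rho$. Then there are constants $\beta_1\in[0,1)$, $\beta_2,\bar\alpha>0$ and $\rho>\bar\alpha\mathcal{R}(u^\dagger)$ such that $$w(u^\dagger)-w(u)\le\beta_1D^{\mathrm{poly}}_w(u;u^\dagger)+\beta_2\|K(u)-v^\dagger\|$$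 holds for all $u\in U$ with $\mathcal{T}_{\bar\alpha}(u;v^\dagger)\le\rho$.
   Context: Notation. $N\wedge n=\min(N,n)$; $\sigma(s)=\binom{n}{s}\binom{N}{s}$; $\tau_2=\sum_{s=2}^{N\wedge n}\sigma(s)$. For $A\in\mathbb{R}^{N\times n}$, $\mathrm{adj}_sA\in\mathbb{R}^{\sigma(s)}$ is the collection of all $s\times s$ minors of $A$ and $T_2(A)=(\mathrm{adj}_2A,\ldots,\mathrm{adj}_{N\wedge n}A)\in\mathbb{R}^{\tau_2}$. $S_2=\prod_{s=2}^{N\wedge n}L^{p/s}(\Omega,\mathbb{R}^{\sigma(s)})$, with dual $S_2^*$ identified with the product of the spaces $L^{(p/s)^*}(\Omega,\mathbb{R}^{\sigma(s)})$ ($^*$ on exponents denotes the Hölder conjugate). For $u\in U$ one has $T_2(\nabla u)\in S_2$ by Hölder's inequality. $W_{\mathrm{poly}}$ is the set of all $w:U\to\mathbb{R}$ for which there is $(u^*,v^* )\in U^*\times S_2^*$ with $w(u)=\langle u^*,u\rangle_{U^*,U}+\langle v^*,T_2(\nabla u)\rangle_{S_2^*,S_2}$ for all $u\in U$. A $W_{\mathrm{poly}}$-subgradient of $\mathcal{R}$ at $u$ with $\mathcal{R}(u)<+\infty$ is a $w\in W_{\mathrm{poly}}$ with $\mathcal{R}(v)\ge\mathcal{R}(u)+w(v)-w(u)$ for all $v\in U$; there are none if $\mathcal{R}(u)=+\infty$. The $W_{\mathrm{poly}}$-Bregman distance is $D^{\mathrm{poly}}_w(v;u)=\mathcal{R}(v)-\mathcal{R}(u)-w(v)+w(u)$.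 An $\mathcal{R}$-minimizing solution is an element $u^\dagger\in\arg\min\{\mathcal{R}(u):u\in U,\ K(u)=v^\dagger\}$; in particular $K(u^\dagger)=v^\dagger$. Gâteaux derivative: for a map $G$ between normed spaces, $G'(u;h)=\lim_{t\to0^+}\frac1t(G(u+th)-G(u))$ if the limit exists; $G$ is Gâteaux differentiable at $u$ if $G'(u;h)$ exists for all $h$ and there is a bounded linear operator $G'(u)$ with $G'(u)h=G'(u;h)$ for all $h$. Every $w\in W_{\mathrm{poly}}$, represented by $(u^*,v^* )$, is Gâteaux differentiable on $U$ with $\langle w'(u),\hat u\rangle_{U^*,U}=\langle u^*,\hat u\rangle_{U^*,U}+\int_\Omega v^*(x)\cdot T_2'(\nabla u(x))\nabla\hat u(x)\,dx$. For a bounded linear operator $A:U\to V$, the dual-adjoint $A^\#:V^*\to U^*$ is defined by $\langle A^\#v^*,u\rangle_{U^*,U}=\langle v^*,Au\rangle_{V^*,V}$ for all $u\in U$, $v^*\in V^*$. *)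

theory Defs
  imports "HOL-Analysis.Analysis"
begin

quotient_type (overloaded) ('a, 'b) ae_fun =
  "'a::euclidean_space \<Rightarrow> 'b" / "\<lambda>f g. AE x in lebesgue. f x = g x"
  morphisms rep_ae_fun abs_ae_fun
proof (rule equivpI)
  show "reflp (\<lambda>f g :: 'a \<Rightarrow> 'b. AE x in lebesgue. f x = g x)"
    by (simp add: reflp_def)
  show "symp (\<lambda>f g :: 'a \<Rightarrow> 'b. AE x in lebesgue. f x = g x)"
    by (auto simp: symp_def elim: eventually_mono)
  show "transp (\<lambda>f g :: 'a \<Rightarrow> 'b. AE x in lebesgue. f x = g x)"
    by (rule transpI) (erule (1) eventually_elim2, simp)
qed

instantiation ae_fun :: (euclidean_space, real_vector) real_vector
begin

lift_definition zero_ae_fun :: "('a, 'b) ae_fun" is "\<lambda>x. 0" .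

lift_definition plus_ae_fun :: "('a, 'b) ae_fun \<Rightarrow> ('a, 'b) ae_fun \<Rightarrow> ('a, 'b) ae_fun"
  is "\<lambda>f g x. f x + g x"
  by (erule (1) eventually_elim2) simp

lift_definition minus_ae_fun :: "('a, 'b) ae_fun \<Rightarrow> ('a, 'b) ae_fun \<Rightarrow> ('a, 'b) ae_fun"
  is "\<lambda>f g x. f x - g x"
  by (erule (1) eventually_elim2) simp

lift_definition uminus_ae_fun :: "('a, 'b) ae_fun \<Rightarrow> ('a, 'b) ae_fun"
  is "\<lambda>f x. - f x"
  by (erule eventually_mono) simp

lift_definition scaleR_ae_fun :: "real \<Rightarrow> ('a, 'b) ae_fun \<Rightarrow> ('a, 'b) ae_fun"
  is "\<lambda>c f x. c *\<^sub>R f x"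
  by (erule eventually_mono) simp

instance
  by standard (transfer; simp add: algebra_simps)+

end

type_synonym ('n, 'N) ae_field = "((real, 'n) vec, (real, 'N) vec) ae_fun"

definition Lp_fun :: "'a::euclidean_space set \<Rightarrow> ereal \<Rightarrow> ('a \<Rightarrow> 'b::euclidean_space) set" where
  "Lp_fun \<Omega> r = {f \<in> borel_measurable (lebesgue_on \<Omega>).
     if r = \<infinity> then \<exists>C. AE x in lebesgue_on \<Omega>. norm (f x) \<le> C
     else integrable (lebesgue_on \<Omega>) (\<lambda>x. norm (f x) powr real_of_ereal r)}"

definition hoelder_conj :: "real \<Rightarrow> ereal" where
  "hoelder_conj r = (if r = 1 then \<infinity> else ereal (r / (r - 1)))"

definition partial_deriv :: "'n \<Rightarrow> (real^'n::finite \<Rightarrow> real) \<Rightarrow> real^'n \<Rightarrow> real" where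
  "partial_deriv j f x = frechet_derivative f (at x) (axis j 1)"

fun C_k :: "nat \<Rightarrow> (real^'n::finite \<Rightarrow> real) \<Rightarrow> bool" where
  "C_k 0 f \<longleftrightarrow> continuous_on UNIV f"
| "C_k (Suc k) f \<longleftrightarrow> f differentiable_on UNIV \<and> (\<forall>j. C_k k (partial_deriv j f))"

definition test_functions :: "(real^'n::finite) set \<Rightarrow> (real^'n \<Rightarrow> real) set" where
  "test_functions \<Omega> = {\<phi>. (\<forall>k. C_k k \<phi>) \<and>
     compact (closure {x. \<phi> x \<noteq> 0}) \<and> closure {x. \<phi> x \<noteq> 0} \<subseteq> \<Omega>}"

(* Local integrability is required explicitly because the Bochner integral of a
   non-integrable function is 0. *)
definition has_weak_gradient ::
  "(real^'n::finite) set \<Rightarrow> (real^'n \<Rightarrow> real^'N::finite) \<Rightarrow> (real^'n \<Rightarrow> real^'n^'N) \<Rightarrow> bool" where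
  "has_weak_gradient \<Omega> u g \<longleftrightarrow>
     (\<forall>C. compact C \<longrightarrow> C \<subseteq> \<Omega> \<longrightarrow> u absolutely_integrable_on C \<and> g absolutely_integrable_on C) \<and>
     (\<forall>\<phi>\<in>test_functions \<Omega>. \<forall>i j.
        (LINT x|lebesgue_on \<Omega>. u x $ i * partial_deriv j \<phi> x) =
        - (LINT x|lebesgue_on \<Omega>. g x $ i $ j * \<phi> x))"

(* A function on \<Omega> is identified with its extension by zero to the whole space; the weak
   gradient only tests inside \<Omega>, so nothing is required across the boundary. All conditions
   are invariant under changing the representative on a null set. *)
definition sobolev ::
  "(real^'n::finite) set \<Rightarrow> real \<Rightarrow> ('n, 'N::finite) ae_field set" where
  "sobolev \<Omega> p = {u. (AE x in lebesgue. x \<notin> \<Omega> \<longrightarrow> rep_ae_fun u x = 0) \<and>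
     rep_ae_fun u \<in> Lp_fun \<Omega> (ereal p) \<and>
     (\<exists>g\<in>Lp_fun \<Omega> (ereal p). has_weak_gradient \<Omega> (rep_ae_fun u) g)}"

(* On sobolev \<Omega> p the weak gradient is unique up to null subsets of \<Omega>. *)
definition weak_gradient ::
  "(real^'n::finite) set \<Rightarrow> ('n, 'N::finite) ae_field \<Rightarrow> real^'n \<Rightarrow> real^'n^'N" where
  "weak_gradient \<Omega> u = (SOME g. has_weak_gradient \<Omega> (rep_ae_fun u) g)"

definition sobolev_norm ::
  "(real^'n::finite) set \<Rightarrow> real \<Rightarrow> ('n, 'N::finite) ae_field \<Rightarrow> real" where
  "sobolev_norm \<Omega> p u =
     ((LINT x|lebesgue_on \<Omega>. norm (rep_ae_fun u x) powr p) +
      (LINT x|lebesgue_on \<Omega>. norm (weak_gradient \<Omega> u x) powr p)) powr (1 / p)"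

(* The vector space X, normed by nrm, is a subspace of its type. *)
definition bounded_linear_on ::
  "'a::real_vector set \<Rightarrow> ('a \<Rightarrow> real) \<Rightarrow> ('a \<Rightarrow> 'b::real_normed_vector) \<Rightarrow> bool" where
  "bounded_linear_on X nrm A \<longleftrightarrow>
     (\<forall>x\<in>X. \<forall>y\<in>X. A (x + y) = A x + A y) \<and>
     (\<forall>c. \<forall>x\<in>X. A (c *\<^sub>R x) = c *\<^sub>R A x) \<and>
     (\<exists>C. \<forall>x\<in>X. norm (A x) \<le> C * nrm x)"

definition has_directional_deriv ::
  "('a::real_vector \<Rightarrow> 'b::real_normed_vector) \<Rightarrow> 'a \<Rightarrow> 'a \<Rightarrow> 'b \<Rightarrow> bool" where
  "has_directional_deriv G u h l \<longleftrightarrow>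
     ((\<lambda>t. (1 / t) *\<^sub>R (G (u + t *\<^sub>R h) - G u)) \<longlongrightarrow> l) (at_right (0::real))"

(* Unspecified where the one-sided limit does not exist. *)
definition gateaux_deriv ::
  "('a::real_vector \<Rightarrow> 'b::real_normed_vector) \<Rightarrow> 'a \<Rightarrow> 'a \<Rightarrow> 'b" where
  "gateaux_deriv G u h = (THE l. has_directional_deriv G u h l)"

definition gateaux_differentiable_on ::
  "'a::real_vector set \<Rightarrow> ('a \<Rightarrow> real) \<Rightarrow> ('a \<Rightarrow> 'b::real_normed_vector) \<Rightarrow> 'a \<Rightarrow> bool" where
  "gateaux_differentiable_on X nrm G u \<longleftrightarrow>
     (\<forall>h\<in>X. \<exists>l. has_directional_deriv G u h l) \<and>
     bounded_linear_on X nrm (gateaux_deriv G u)"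

definition dual_adjoint ::
  "('a \<Rightarrow> 'b::real_normed_vector) \<Rightarrow> ('b \<Rightarrow>\<^sub>L real) \<Rightarrow> 'a \<Rightarrow> real" where
  "dual_adjoint A \<omega> = (\<lambda>u. blinfun_apply \<omega> (A u))"

(* The minor with rows I and columns J (both in increasing order), by the Leibniz formula.
   The linear orders on the index types fix the sign; every finite dimension has such a type. *)
definition minor ::
  "real^'n::{finite,linorder}^'N::{finite,linorder} \<Rightarrow> 'N set \<Rightarrow> 'n set \<Rightarrow> real" where
  "minor A I J =
     (\<Sum>\<pi> | \<pi> permutes {..<card I}. of_int (sign \<pi>) *
        (\<Prod>k<card I. A $ (sorted_list_of_set I ! k) $ (sorted_list_of_set J ! \<pi> k)))"

(* The vector of s-minors is indexed by all pairs (I, J); the entries with card I \<noteq> s or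
   card J \<noteq> s are padding and vanish, leaving binomial(N, s) * binomial(n, s) genuine ones. *)
definition adj_minors ::
  "nat \<Rightarrow> real^'n::{finite,linorder}^'N::{finite,linorder} \<Rightarrow> real^('N set \<times> 'n set)" where
  "adj_minors s A = (\<chi> IJ. if card (fst IJ) = s \<and> card (snd IJ) = s
     then minor A (fst IJ) (snd IJ) else 0)"

(* S_2 is the product over s of the spaces L^(p/s), so an element of its dual is a family v with
   v s in the L-space of the conjugate exponent of p/s; the padding entries of v s do not
   contribute to the pairing. Only the values of w on the Sobolev space are constrained. *)
definition W_poly ::
  "(real^'n::{finite,linorder}) set \<Rightarrow> real \<Rightarrow>
   (('n, 'N::{finite,linorder}) ae_field \<Rightarrow> real) set" where
  "W_poly \<Omega> p = {w. \<exists>ustar v.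
     bounded_linear_on (sobolev \<Omega> p) (sobolev_norm \<Omega> p) ustar \<and>
     (\<forall>s\<in>{2..min CARD('N) CARD('n)}. v s \<in> Lp_fun \<Omega> (hoelder_conj (p / real s))) \<and>
     (\<forall>u\<in>sobolev \<Omega> p. w u = ustar u +
        (\<Sum>s = 2..min CARD('N) CARD('n).
           LINT x|lebesgue_on \<Omega>. v s x \<bullet> adj_minors s (weak_gradient \<Omega> u x)))}"

definition poly_subgradient ::
  "(real^'n::{finite,linorder}) set \<Rightarrow> real \<Rightarrow>
   (('n, 'N::{finite,linorder}) ae_field \<Rightarrow> ereal) \<Rightarrow>
   ('n, 'N) ae_field \<Rightarrow> (('n, 'N) ae_field \<Rightarrow> real) \<Rightarrow> bool" where
  "poly_subgradient \<Omega> p R u w \<longleftrightarrow> R u < \<infinity> \<and> w \<in> W_poly \<Omega> p \<and>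
     (\<forall>v\<in>sobolev \<Omega> p. R v \<ge> R u + ereal (w v) - ereal (w u))"

definition bregman_poly :: "('u \<Rightarrow> ereal) \<Rightarrow> ('u \<Rightarrow> real) \<Rightarrow> 'u \<Rightarrow> 'u \<Rightarrow> ereal" where
  "bregman_poly R w v u = R v - R u - ereal (w v) + ereal (w u)"

definition minimizing_solution ::
  "'u set \<Rightarrow> ('u \<Rightarrow> 'v) \<Rightarrow> 'v \<Rightarrow> ('u \<Rightarrow> ereal) \<Rightarrow> 'u \<Rightarrow> bool" where
  "minimizing_solution U K vdag R u \<longleftrightarrow>
     u \<in> U \<and> K u = vdag \<and> (\<forall>u'\<in>U. K u' = vdag \<longrightarrow> R u \<le> R u')"

definition tikhonov ::
  "('u \<Rightarrow> 'v::real_normed_vector) \<Rightarrow> ('u \<Rightarrow> ereal) \<Rightarrow> real \<Rightarrow> real \<Rightarrow> 'u \<Rightarrow> 'v \<Rightarrow> ereal" where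
  "tikhonov K R q \<alpha> u vdag = ereal (norm (K u - vdag) powr q) + ereal \<alpha> * R u"

end

theory Submission
  imports Defs
begin

text \<open>By the source condition, \<open>\<langle>w'(u\<dagger>), u\<dagger> - u\<rangle> = - \<langle>\<omega>, K'(u\<dagger>)(u - u\<dagger>)\<rangle>\<close>. Adding and subtracting
  \<open>\<langle>\<omega>, K(u) - v\<dagger>\<rangle>\<close> bounds it by \<open>\<parallel>\<omega>\<parallel>\<close> times the linearization error plus \<open>\<parallel>\<omega>\<parallel> \<parallel>K(u) - v\<dagger>\<parallel>\<close>;
  the former is absorbed by the nonlinearity condition. All constants except \<open>\<beta>\<^sub>2 = \<parallel>\<omega>\<parallel> + 1\<close> (the 1
  makes it positive) are kept. Moving the sign requires \<open>u - u\<dagger>\<close> to lie in the Sobolev space,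
  since \<open>K'(u\<dagger>)\<close> is linear only there.\<close>

text \<open>\<open>rep_ae_fun\<close> picks an arbitrary member of each class, so subtraction
  commutes with it only up to a null set. This is why the closure properties below are also needed
  in a form that tolerates a.e. changes.\<close>

lemma rep_ae_fun_minus:
  "AE x in lebesgue. rep_ae_fun u x - rep_ae_fun v x = rep_ae_fun (u - v) x"
proof -
  have "u - v = abs_ae_fun (\<lambda>x. rep_ae_fun u x - rep_ae_fun v x)"
    by (simp add: minus_ae_fun_def)
  then have "AE x in lebesgue. rep_ae_fun (u - v) x = rep_ae_fun u x - rep_ae_fun v x"
    by (simp add: Quotient3_rep_abs [OF Quotient3_ae_fun])
  then show ?thesis
    by eventually_elim simp
qed

lemma Lp_fun_cong_AE:
  assumes "f \<in> Lp_fun \<Omega> (ereal r)" "\<Omega> \<in> sets lebesgue" "AE x in lebesgue. f x = g x"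
  shows "g \<in> Lp_fun \<Omega> (ereal r)"
proof -
  have meas: "f \<in> borel_measurable (lebesgue_on \<Omega>)"
    and int: "integrable (lebesgue_on \<Omega>) (\<lambda>x. norm (f x) powr r)"
    using assms(1) by (auto simp: Lp_fun_def)
  \<comment> \<open>Extension by zero moves the question from \<open>lebesgue_on \<Omega>\<close> to
    \<open>lebesgue\<close>, whose completeness lets measurability pass to an a.e. equal
    function.\<close>
  have "(\<lambda>x. if x \<in> \<Omega> then f x else 0) \<in> borel_measurable lebesgue"
    using meas assms(2) by (simp add: borel_measurable_if)
  moreover have "AE x in lebesgue. (if x \<in> \<Omega> then f x else 0) = (if x \<in> \<Omega> then g x else 0)"
    using assms(3) by eventually_elim simp
  ultimately have "(\<lambda>x. if x \<in> \<Omega> then g x else 0) \<in> borel_measurable lebesgue"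
    by (rule borel_measurable_AE)
  then have gm: "g \<in> borel_measurable (lebesgue_on \<Omega>)"
    using assms(2) by (simp add: borel_measurable_if)
  have "AE x in lebesgue. x \<in> \<Omega> \<longrightarrow> norm (f x) powr r = norm (g x) powr r"
    using assms(3) by eventually_elim simp
  then have "AE x in lebesgue_on \<Omega>. norm (f x) powr r = norm (g x) powr r"
    using assms(2) by (simp add: AE_restrict_space_iff)
  then have "integrable (lebesgue_on \<Omega>) (\<lambda>x. norm (g x) powr r)"
    using gm by (intro integrable_cong_AE_imp [OF int]) simp_all
  then show ?thesis
    using gm by (simp add: Lp_fun_def)
qed

lemma Lp_fun_diff:
  assumes f: "f \<in> Lp_fun \<Omega> (ereal r)" and g: "g \<in> Lp_fun \<Omega> (ereal r)" and "0 \<le> r"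
  shows "(\<lambda>x. f x - g x) \<in> Lp_fun \<Omega> (ereal r)"
proof -
  have [measurable]: "f \<in> borel_measurable (lebesgue_on \<Omega>)" "g \<in> borel_measurable (lebesgue_on \<Omega>)"
    and int: "integrable (lebesgue_on \<Omega>) (\<lambda>x. norm (f x) powr r)"
      "integrable (lebesgue_on \<Omega>) (\<lambda>x. norm (g x) powr r)"
    using f g by (auto simp: Lp_fun_def)
  \<comment> \<open>A crude substitute for Minkowski's inequality, enough for membership: the norm
    of the difference is at most twice the larger norm, and the power of a maximum is at most the
    sum of the powers.\<close>
  have bound: "norm (a - b) powr r \<le> 2 powr r * (norm a powr r + norm b powr r)" for a b :: 'b
  proof -
    have "norm (a - b) \<le> 2 * max (norm a) (norm b)"
      using norm_triangle_ineq4 [of a b] by linarith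
    then have "norm (a - b) powr r \<le> (2 * max (norm a) (norm b)) powr r"
      using \<open>0 \<le> r\<close> by (intro powr_mono2) auto
    also have "\<dots> = 2 powr r * max (norm a) (norm b) powr r"
      by (subst powr_mult) (auto simp: max_def)
    also have "\<dots> \<le> 2 powr r * (norm a powr r + norm b powr r)"
      by (intro mult_left_mono) (auto simp: max_def)
    finally show ?thesis .
  qed
  have "integrable (lebesgue_on \<Omega>) (\<lambda>x. 2 powr r * (norm (f x) powr r + norm (g x) powr r))"
    using int by simp
  then have "integrable (lebesgue_on \<Omega>) (\<lambda>x. norm (f x - g x) powr r)"
    by (rule Bochner_Integration.integrable_bound) (use bound in auto)
  then show ?thesis
    by (simp add: Lp_fun_def)
qed

lemma absolutely_integrable_on_cong_AE:
  fixes f g :: "'a::euclidean_space \<Rightarrow> 'b::euclidean_space"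
  assumes f: "f absolutely_integrable_on C" and "AE x in lebesgue. f x = g x"
  shows "g absolutely_integrable_on C"
proof -
  have int: "integrable lebesgue (\<lambda>x. indicator C x *\<^sub>R f x)"
    using f by (simp add: set_integrable_def)
  have eq: "AE x in lebesgue. indicator C x *\<^sub>R f x = indicator C x *\<^sub>R g x"
    using assms(2) by eventually_elim simp
  have "(\<lambda>x. indicator C x *\<^sub>R g x) \<in> borel_measurable lebesgue"
    using borel_measurable_AE [OF borel_measurable_integrable [OF int] eq] .
  then show ?thesis
    unfolding set_integrable_def using eq by (rule integrable_cong_AE_imp [OF int])
qed

text \<open>Off the closed support, the function vanishes on a whole neighbourhood. Hence partial
  derivatives of test functions live on the same compact set, as integration against them
  requires.\<close>

lemma partial_deriv_eq_0_outside_support: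
  fixes \<phi> :: "real^'n::finite \<Rightarrow> real"
  assumes "x \<notin> closure {x. \<phi> x \<noteq> 0}"
  shows "partial_deriv j \<phi> x = 0"
proof -
  have "(\<phi> has_derivative (\<lambda>h. 0)) (at x)"
  proof (rule has_derivative_transform_within_open)
    show "((\<lambda>x. 0) has_derivative (\<lambda>h. 0)) (at x)" by simp
    show "open (- closure {x. \<phi> x \<noteq> 0})" by (simp add: open_Compl)
    show "x \<in> - closure {x. \<phi> x \<noteq> 0}" using assms by simp
    show "0 = \<phi> y" if "y \<in> - closure {x. \<phi> x \<noteq> 0}" for y
      using that closure_subset [of "{x. \<phi> x \<noteq> 0}"] by auto
  qed
  then show ?thesis
    by (simp add: partial_deriv_def frechet_derivative_at [symmetric])
qed

text \<open>On the compact set \<open>C\<close> the continuous factor is bounded, so the product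
  with \<open>f\<close> is integrable there; off \<open>C\<close> it vanishes. Thus local
  integrability of \<open>f\<close> gives integrability over all of \<open>\<Omega>\<close>.\<close>

lemma integrable_mult_compactly_supported:
  fixes f :: "'a::euclidean_space \<Rightarrow> real" and \<psi> :: "'a \<Rightarrow> real"
  assumes f: "f absolutely_integrable_on C" and \<psi>: "continuous_on UNIV \<psi>"
    and C: "compact C" "C \<subseteq> \<Omega>" and supp: "\<And>x. x \<notin> C \<Longrightarrow> \<psi> x = 0"
    and \<Omega>: "\<Omega> \<in> sets lebesgue"
  shows "integrable (lebesgue_on \<Omega>) (\<lambda>x. f x * \<psi> x)"
proof -
  have Cset: "C \<in> sets lebesgue"
    using C(1) by (simp add: lmeasurable_compact fmeasurableD)
  have cont: "continuous_on C \<psi>"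
    using \<psi> continuous_on_subset by blast
  have "(\<lambda>x. \<psi> x * f x) absolutely_integrable_on C"
    using cont Cset C(1) f
    by (intro absolutely_integrable_bounded_measurable_product [OF bilinear_times]
        continuous_imp_measurable_on_sets_lebesgue compact_imp_bounded compact_continuous_image)
  \<comment> \<open>Both indicators cut out the same function, since \<open>\<psi>\<close> vanishes
    off \<open>C\<close> and \<open>C\<close> lies in \<open>\<Omega>\<close>.\<close>
  moreover have "indicator C x *\<^sub>R (\<psi> x * f x) = indicator \<Omega> x *\<^sub>R (f x * \<psi> x)" for x
    using C(2) supp [of x] by (cases "x \<in> C") auto
  ultimately show ?thesis
    using \<Omega> by (subst integrable_restrict_space) (simp_all only: set_integrable_def space_completion space_lborel
        space_borel Int_UNIV_right)
qed

lemma absolutely_integrable_on_vec_nth: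
  fixes f :: "'a::euclidean_space \<Rightarrow> 'b::euclidean_space^'k::finite"
  assumes "f absolutely_integrable_on C"
  shows "(\<lambda>x. f x $ i) absolutely_integrable_on C"
  using absolutely_integrable_linear [OF assms bounded_linear_vec_nth] by (simp add: o_def)

text \<open>The defining identities are subtracted. Splitting a Bochner integral of a difference
  requires both integrals to exist, which follows from local integrability and the compact support
  of the test function. The a.e. variant \<open>d\<close> stands for the representative of a
  difference class.\<close>

lemma has_weak_gradient_diff_AE:
  fixes \<Omega> :: "(real^'n::finite) set" and u v d :: "real^'n \<Rightarrow> real^'N::finite"
  assumes \<Omega>: "\<Omega> \<in> sets lebesgue"
    and u: "has_weak_gradient \<Omega> u g" and v: "has_weak_gradient \<Omega> v h"
    and d: "AE x in lebesgue. u x - v x = d x"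
  shows "has_weak_gradient \<Omega> d (\<lambda>x. g x - h x)"
proof -
  let ?k = "\<lambda>x. g x - h x"
  have loc: "u absolutely_integrable_on C" "v absolutely_integrable_on C" "d absolutely_integrable_on C"
      "g absolutely_integrable_on C" "h absolutely_integrable_on C" "?k absolutely_integrable_on C"
    if "compact C" "C \<subseteq> \<Omega>" for C
  proof -
    show *: "u absolutely_integrable_on C" "v absolutely_integrable_on C"
        "g absolutely_integrable_on C" "h absolutely_integrable_on C"
      using u v that unfolding has_weak_gradient_def by blast+
    then show "?k absolutely_integrable_on C" by (intro set_integral_diff)
    show "d absolutely_integrable_on C"
    proof (rule absolutely_integrable_on_cong_AE)
      show "(\<lambda>x. u x - v x) absolutely_integrable_on C" using * by (intro set_integral_diff)
    qed (rule d)
  qed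
  have "(LINT x|lebesgue_on \<Omega>. d x $ i * partial_deriv j \<phi> x) =
      - (LINT x|lebesgue_on \<Omega>. ?k x $ i $ j * \<phi> x)"
    if \<phi>: "\<phi> \<in> test_functions \<Omega>" for \<phi> i j
  proof -
    let ?C = "closure {x. \<phi> x \<noteq> 0}"
    have C: "compact ?C" "?C \<subseteq> \<Omega>" and smooth: "\<And>k. C_k k \<phi>"
      using \<phi> by (auto simp: test_functions_def)
    have supp: "\<phi> x = 0" if "x \<notin> ?C" for x
      using that closure_subset [of "{x. \<phi> x \<noteq> 0}"] by auto
    \<comment> \<open>Continuity of the function is \<open>C_k 0\<close>; continuity of its partial
      derivatives is the recursive part of \<open>C_k (Suc 0)\<close>.\<close>
    have cont: "continuous_on UNIV \<phi>" "continuous_on UNIV (partial_deriv j \<phi>)"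
      using smooth [of 0] smooth [of "Suc 0"] by auto
    have int_deriv: "integrable (lebesgue_on \<Omega>) (\<lambda>x. f x $ i * partial_deriv j \<phi> x)"
      if "f absolutely_integrable_on ?C" for f :: "real^'n \<Rightarrow> real^'N"
      by (rule integrable_mult_compactly_supported [OF absolutely_integrable_on_vec_nth [OF that] cont(2) C _ \<Omega>])
        (rule partial_deriv_eq_0_outside_support)
    have int: "integrable (lebesgue_on \<Omega>) (\<lambda>x. f x $ i $ j * \<phi> x)"
      if "f absolutely_integrable_on ?C" for f :: "real^'n \<Rightarrow> real^'n^'N"
      by (rule integrable_mult_compactly_supported
          [OF absolutely_integrable_on_vec_nth [OF absolutely_integrable_on_vec_nth [OF that]] cont(1) C supp \<Omega>])
    note id = int_deriv [OF loc(1) [OF C]] int_deriv [OF loc(2) [OF C]] int_deriv [OF loc(3) [OF C]]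
    note ii = int [OF loc(4) [OF C]] int [OF loc(5) [OF C]]
    have "AE x in lebesgue. x \<in> \<Omega> \<longrightarrow> d x $ i * partial_deriv j \<phi> x =
        u x $ i * partial_deriv j \<phi> x - v x $ i * partial_deriv j \<phi> x"
      using d by eventually_elim (simp flip: left_diff_distrib vector_minus_component)
    then have "AE x in lebesgue_on \<Omega>. d x $ i * partial_deriv j \<phi> x =
        u x $ i * partial_deriv j \<phi> x - v x $ i * partial_deriv j \<phi> x"
      using \<Omega> by (simp add: AE_restrict_space_iff)
    \<comment> \<open>The a.e. congruence for integrals asks for measurability of both integrands,
      obtained here from their integrability; this includes the integrand with
      \<open>d\<close>.\<close>
    then have "(LINT x|lebesgue_on \<Omega>. d x $ i * partial_deriv j \<phi> x) =
        (LINT x|lebesgue_on \<Omega>. u x $ i * partial_deriv j \<phi> x - v x $ i * partial_deriv j \<phi> x)"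
      using id by (intro integral_cong_AE borel_measurable_integrable Bochner_Integration.integrable_diff)
    also have "\<dots> = (LINT x|lebesgue_on \<Omega>. u x $ i * partial_deriv j \<phi> x) -
        (LINT x|lebesgue_on \<Omega>. v x $ i * partial_deriv j \<phi> x)"
      using id by simp
    also have "\<dots> = - (LINT x|lebesgue_on \<Omega>. g x $ i $ j * \<phi> x) + (LINT x|lebesgue_on \<Omega>. h x $ i $ j * \<phi> x)"
      using u v \<phi> by (simp add: has_weak_gradient_def)
    also have "\<dots> = - (LINT x|lebesgue_on \<Omega>. ?k x $ i $ j * \<phi> x)"
      using ii by (simp add: left_diff_distrib)
    finally show ?thesis .
  qed
  then show ?thesis
    unfolding has_weak_gradient_def using loc(3,6) by (intro conjI allI impI ballI)
qed

text \<open>The witness for the gradient is the difference of the two given \<open>L^p\<close>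
  witnesses, which may differ from the gradients selected by \<open>weak_gradient\<close>.\<close>

lemma sobolev_diff:
  assumes \<Omega>: "open \<Omega>" and "0 \<le> p" and u: "u \<in> sobolev \<Omega> p" and v: "v \<in> sobolev \<Omega> p"
  shows "u - v \<in> sobolev \<Omega> p"
proof -
  have \<Omega>_sets: "\<Omega> \<in> sets lebesgue"
    using \<Omega> by (simp add: borel_open)
  note rep = rep_ae_fun_minus [of u v]
  have Lp: "rep_ae_fun u \<in> Lp_fun \<Omega> (ereal p)" "rep_ae_fun v \<in> Lp_fun \<Omega> (ereal p)"
    and zero: "AE x in lebesgue. x \<notin> \<Omega> \<longrightarrow> rep_ae_fun u x = 0"
      "AE x in lebesgue. x \<notin> \<Omega> \<longrightarrow> rep_ae_fun v x = 0"
    using u v by (auto simp: sobolev_def)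
  obtain g h where gh: "g \<in> Lp_fun \<Omega> (ereal p)" "has_weak_gradient \<Omega> (rep_ae_fun u) g"
      "h \<in> Lp_fun \<Omega> (ereal p)" "has_weak_gradient \<Omega> (rep_ae_fun v) h"
    using u v by (auto simp: sobolev_def)
  have "AE x in lebesgue. x \<notin> \<Omega> \<longrightarrow> rep_ae_fun (u - v) x = 0"
    using rep zero by eventually_elim (metis diff_zero)
  moreover have "rep_ae_fun (u - v) \<in> Lp_fun \<Omega> (ereal p)"
    by (rule Lp_fun_cong_AE [OF Lp_fun_diff [OF Lp \<open>0 \<le> p\<close>] \<Omega>_sets rep])
  moreover have "(\<lambda>x. g x - h x) \<in> Lp_fun \<Omega> (ereal p)"
    using gh \<open>0 \<le> p\<close> by (intro Lp_fun_diff)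
  moreover have "has_weak_gradient \<Omega> (rep_ae_fun (u - v)) (\<lambda>x. g x - h x)"
    using gh rep by (intro has_weak_gradient_diff_AE [OF \<Omega>_sets])
  ultimately show ?thesis
    unfolding sobolev_def by blast
qed

theorem theorem2:
  fixes \<Omega> :: "(real^'n::{finite,linorder}) set"
    and p q :: real
    and U :: "('n, 'N::{finite,linorder}) ae_field set"
    and K :: "('n, 'N) ae_field \<Rightarrow> 'v::banach"
    and vdag :: 'v
    and R :: "('n, 'N) ae_field \<Rightarrow> ereal"
    and udag :: "('n, 'N) ae_field"
    and w :: "('n, 'N) ae_field \<Rightarrow> real"
    and \<omega> :: "'v \<Rightarrow>\<^sub>L real"
    and \<beta>\<^sub>1 \<alpha> \<rho> :: real
  defines "U \<equiv> sobolev \<Omega> p"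
  assumes "open \<Omega>"
    and "1 \<le> p" and "real (min CARD('N) CARD('n)) \<le> p"
    and "1 \<le> q"
    and "\<forall>u\<in>U. R u \<noteq> -\<infinity>"
    and "minimizing_solution U K vdag R udag"
    and "gateaux_differentiable_on U (sobolev_norm \<Omega> p) K udag"
    and "poly_subgradient \<Omega> p R udag w"
    and "0 \<le> \<beta>\<^sub>1" and "\<beta>\<^sub>1 < 1" and "0 < \<alpha>"
    and "ereal \<rho> > ereal \<alpha> * R udag"
    and source: "\<forall>h\<in>U. gateaux_deriv w udag h = dual_adjoint (gateaux_deriv K udag) \<omega> h"
    and nonlinearity: "\<forall>u\<in>U. tikhonov K R q \<alpha> u vdag \<le> ereal \<rho> \<longrightarrow>
      ereal (norm \<omega> * norm (K u - vdag - gateaux_deriv K udag (u - udag))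
             + w udag - w u - gateaux_deriv w udag (udag - u))
        \<le> ereal \<beta>\<^sub>1 * bregman_poly R w u udag"
  shows "\<exists>\<beta>\<^sub>1 \<beta>\<^sub>2 \<alpha> \<rho>. 0 \<le> \<beta>\<^sub>1 \<and> \<beta>\<^sub>1 < 1 \<and> 0 < \<beta>\<^sub>2 \<and> 0 < \<alpha> \<and> ereal \<rho> > ereal \<alpha> * R udag \<and>
    (\<forall>u\<in>U. tikhonov K R q \<alpha> u vdag \<le> ereal \<rho> \<longrightarrow>
      ereal (w udag - w u)
        \<le> ereal \<beta>\<^sub>1 * bregman_poly R w u udag + ereal (\<beta>\<^sub>2 * norm (K u - vdag)))"
proof (rule exI [of _ \<beta>\<^sub>1], rule exI [of _ "norm \<omega> + 1"], rule exI [of _ \<alpha>],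
    rule exI [of _ \<rho>], intro conjI ballI impI)
  show "0 < norm \<omega> + 1"
    by (simp add: add_nonneg_pos)
  have udag: "udag \<in> U" and lin: "bounded_linear_on U (sobolev_norm \<Omega> p) (gateaux_deriv K udag)"
    using \<open>minimizing_solution U K vdag R udag\<close>
      \<open>gateaux_differentiable_on U (sobolev_norm \<Omega> p) K udag\<close>
    by (simp_all add: minimizing_solution_def gateaux_differentiable_on_def)
  fix u assume u: "u \<in> U" and level: "tikhonov K R q \<alpha> u vdag \<le> ereal \<rho>"
  let ?r = "K u - vdag"
  let ?A = "gateaux_deriv K udag (u - udag)"
  have mem: "u - udag \<in> U" "udag - u \<in> U"
    using sobolev_diff [OF \<open>open \<Omega>\<close>, of p] u udag \<open>1 \<le> p\<close> by (simp_all add: U_def)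
  \<comment> \<open>One-sided limits alone yield only positive homogeneity; the factor -1 comes from
    the linearity contained in Gateaux differentiability.\<close>
  have "gateaux_deriv K udag ((-1) *\<^sub>R (u - udag)) = (-1) *\<^sub>R ?A"
    using lin mem unfolding bounded_linear_on_def by blast
  then have "gateaux_deriv w udag (udag - u) = - blinfun_apply \<omega> ?A"
    using source mem by (simp add: dual_adjoint_def blinfun.minus_right)
  also have "\<dots> = blinfun_apply \<omega> (?r - ?A) - blinfun_apply \<omega> ?r"
    by (simp add: blinfun.diff_right)
  also have "\<dots> \<le> norm \<omega> * norm (?r - ?A) + norm \<omega> * norm ?r"
    using norm_blinfun [of \<omega> "?r - ?A"] norm_blinfun [of \<omega> ?r] by auto
  \<comment> \<open>The derivative term cancels against its upper bound. The added 1 contributes the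
    nonnegative slack \<open>norm ?r\<close>; distributing it leaves the products as atoms for
    linear arithmetic.\<close>
  finally have "w udag - w u \<le> (norm \<omega> * norm (?r - ?A) + w udag - w u
      - gateaux_deriv w udag (udag - u)) + (norm \<omega> + 1) * norm ?r"
    using norm_ge_zero [of ?r] unfolding distrib_right mult_1_left by linarith
  \<comment> \<open>The estimate is lifted to \<open>ereal\<close> before
    \<open>bregman_poly\<close> enters, so the remaining step is monotonicity of addition and
    finiteness of the Bregman distance need not be established.\<close>
  then have "ereal (w udag - w u) \<le> ereal (norm \<omega> * norm (?r - ?A) + w udag - w u
      - gateaux_deriv w udag (udag - u)) + ereal ((norm \<omega> + 1) * norm ?r)"
    by simp
  also have "\<dots> \<le> ereal \<beta>\<^sub>1 * bregman_poly R w u udag + ereal ((norm \<omega> + 1) * norm ?r)"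
    using nonlinearity u level by (intro add_right_mono) blast
  finally show "ereal (w udag - w u)
      \<le> ereal \<beta>\<^sub>1 * bregman_poly R w u udag + ereal ((norm \<omega> + 1) * norm (K u - vdag))" .
qed (simp_all only: \<open>0 \<le> \<beta>\<^sub>1\<close> \<open>\<beta>\<^sub>1 < 1\<close> \<open>0 < \<alpha>\<close> \<open>ereal \<rho> > ereal \<alpha> * R udag\<close>)

end
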